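(* Let $k$ be a positive real number. The rising $k$-binomial transform $(r_{k,n})_{n\ge 0}$ of the modified $k$-Fibonacci-like sequence satisfies the recurrence relation $$r_{k,n+1} = (k^{2}+2)\,r_{k,n} - r_{k,n-1}\quad\text{for all integers } n\ge 1,$$ with the initial conditions $r_{k,0}=2$ and $r_{k,1}=2k+2$.
   Context: For a positive real number $k$, the modified $k$-Fibonacci-like sequence $(M_{k,n})_{n\ge 0}$ is defined by $M_{k,0}=M_{k,1}=2$ and $M_{k,n+1}=kM_{k,n}+M_{k,n-1}$ for $n\ge 1$. Its rising $k$-binomial transform $(r_{k,n})_{n\ge 0}$ is defined by $r_{k,n}=\sum_{i=0}^{n}\binom{n}{i}k^{i}M_{k,i}$. *)

theory Defs
  imports Complex_Main
begin

fun fib_like :: "real \<Rightarrow> nat \<Rightarrow> real" where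
  "fib_like k 0 = 2"
| "fib_like k (Suc 0) = 2"
| "fib_like k (Suc (Suc n)) = k * fib_like k (Suc n) + fib_like k n"

definition rising_binomial_transform :: "real \<Rightarrow> (nat \<Rightarrow> real) \<Rightarrow> nat \<Rightarrow> real" where
  "rising_binomial_transform k a n = (\<Sum>i=0..n. real (n choose i) * k ^ i * a i)"

end

theory Submission
  imports Defs
begin

text \<open>
  The key fact is that the transform merely extracts the even-indexed terms:
  \<open>r n = fib_like k (2 * n)\<close>.  Write \<open>S\<close> for the shift on sequences.  The transform of \<open>a\<close>
  at \<open>n\<close> is the zeroth term of \<open>(1 + k S)\<^sup>n a\<close>, by the binomial theorem, and the recurrence
  \<open>a (i + 2) = k * a (i + 1) + a i\<close> says precisely that \<open>1 + k S\<close> acts on \<open>a\<close> as \<open>S\<^sup>2\<close>.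

  The claimed recurrence is therefore that of the even-indexed terms: if \<open>\<alpha>\<close> and \<open>\<beta>\<close> are the
  roots of \<open>x\<^sup>2 = k x + 1\<close>, then \<open>\<alpha>\<^sup>2\<close> and \<open>\<beta>\<^sup>2\<close> have sum \<open>k\<^sup>2 + 2\<close> and product \<open>1\<close>.
  The initial values are the terms of index \<open>0\<close> and \<open>2\<close> of the original sequence.
\<close>

text \<open>
  This is Pascal's rule, read as \<open>(1 + k S)\<^bsup>n+1\<^esup> = (1 + k S)\<^sup>n (1 + k S)\<close>.
\<close>
lemma rising_binomial_transform_Suc:
  "rising_binomial_transform k a (Suc n) =
     rising_binomial_transform k (\<lambda>i. a i + k * a (Suc i)) n"
proof -
  have "rising_binomial_transform k a (Suc n) =
      a 0 + (\<Sum>i=0..n. real (n choose Suc i) * k ^ Suc i * a (Suc i))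
          + (\<Sum>i=0..n. real (n choose i) * k ^ Suc i * a (Suc i))"
    unfolding rising_binomial_transform_def
    by (subst sum.atLeast0_atMost_Suc_shift)
       (simp add: sum.distrib [symmetric] algebra_simps del: sum.cl_ivl_Suc)
  also have "a 0 + (\<Sum>i=0..n. real (n choose Suc i) * k ^ Suc i * a (Suc i)) =
      (\<Sum>i=0..Suc n. real (n choose i) * k ^ i * a i)"
    by (subst sum.atLeast0_atMost_Suc_shift) simp
  also have "\<dots> = (\<Sum>i=0..n. real (n choose i) * k ^ i * a i)"
    by simp
  finally show ?thesis
    by (simp add: rising_binomial_transform_def sum.distrib [symmetric] algebra_simps)
qed

text \<open>
  The induction has to vary \<open>a\<close>: one application of \<open>1 + k S\<close> replaces \<open>a\<close> by its double
  shift, which satisfies the same recurrence with other initial values.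
\<close>
lemma rising_binomial_transform_eq_even_term:
  assumes "\<And>i. a (Suc (Suc i)) = k * a (Suc i) + a i"
  shows "rising_binomial_transform k a n = a (2 * n)"
  using assms
proof (induction n arbitrary: a)
  case 0
  show ?case by (simp add: rising_binomial_transform_def)
next
  case (Suc n)
  have "rising_binomial_transform k a (Suc n) =
      rising_binomial_transform k (\<lambda>i. a (Suc (Suc i))) n"
    by (simp add: rising_binomial_transform_Suc Suc.prems add.commute)
  also have "\<dots> = a (Suc (Suc (2 * n)))"
    by (rule Suc.IH) (rule Suc.prems)
  finally show ?case by simp
qed

lemma even_term_recurrence:
  fixes a :: "nat \<Rightarrow> real"
  assumes "\<And>i. a (Suc (Suc i)) = k * a (Suc i) + a i"
  shows "a (2 * (n + 2)) = (k\<^sup>2 + 2) * a (2 * (n + 1)) - a (2 * n)"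
  by (simp add: assms algebra_simps power2_eq_square)

theorem theorem9:
  fixes k :: real
  assumes "k > 0"
  defines "r \<equiv> rising_binomial_transform k (fib_like k)"
  shows "(\<forall>n\<ge>1. r (n + 1) = (k\<^sup>2 + 2) * r n - r (n - 1)) \<and> r 0 = 2 \<and> r 1 = 2 * k + 2"
proof -
  have r: "r n = fib_like k (2 * n)" for n
    unfolding r_def by (rule rising_binomial_transform_eq_even_term) simp
  have "r (n + 1) = (k\<^sup>2 + 2) * r n - r (n - 1)" if "n \<ge> 1" for n
    using even_term_recurrence [of "fib_like k" k "n - 1"] that by (simp add: r)
  moreover have "r 0 = 2" "r 1 = 2 * k + 2"
    by (simp_all add: r numeral_2_eq_2)
  ultimately show ?thesis by blast
qed

end
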